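(* Let $X$ be a topological space with the property $BP_3'$ in which there is a closed nowhere dense set $F\subset X$ which is homeomorphic with the Cantor set. Then: (1) There exists an additive group (of functions $X\to\mathbb Z$, under pointwise addition) of size $\mathfrak c$ contained in the family of all non-Borel super quasi-continuous functions from $X$ to $\mathbb Z$ plus the zero function. (2) For each $\mathbb K\in\{\mathbb Q,\mathbb R,\mathbb C\}$ there is a $\mathfrak c$-dimensional linear space over $\mathbb K$ contained in the family of all non-Borel super quasi-continuous functions from $X$ to $\mathbb K$ plus the zero function. (3) There exists a cone contained in the family of all non-Borel super quasi-continuous functions from $X$ to $\mathbb R$ plus the zero function that is spanned by $2^{\mathfrak c}$ linearly independent generators. (4) There is a lattice of size $2^{\mathfrak c}$ (under pointwise maximum and minimum) contained in the family of all non-Borel super quasi-continuous functions from $X$ to $\{0,1\}$.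
   Context: $\mathbb N=\{0,1,2,\dots\}$ and $\mathfrak c=2^{\aleph_0}$. $\mathbb Z$ and $\{0,1\}$ carry the discrete topology, and $\mathbb Q,\mathbb R,\mathbb C$ their usual topologies. Property $BP_3'$: a topological space $X$ has property $BP_3'$ if for every nowhere dense set $F\subset X$ there is a sequence $(U_m)_{m\in\mathbb N}$ of pairwise disjoint non-empty open sets such that (i') $U_m\cap F=\emptyset$ for all $m\in\mathbb N$; (ii') $F\subset\mathrm{cl}(U_m)$ for each $m\in\mathbb N$; (iii') $X\setminus(F\cup\bigcup_{m>0}U_m)\subset\mathrm{cl}(U_0)$. A function $f\colon X\to Y$ between topological spaces is super quasi-continuous if for each $x_0\in X$, each neighbourhood $W$ of $x_0$ and each neighbourhood $V$ of $f(x_0)$ there is $x\in C_f\cap W$ with $f(x)\in V$, where $C_f$ is the set of continuity points of $f$. A function is non-Borel if it is not Borel measurable, i.e. the preimage of some open set is not a Borel set. The (positive) cone spanned by a set $B$ of linearly independent vectors is the set of all finite sums $\sum_{i=1}^n a_ix_i$ with $n\ge 1$, $a_1,\dots,a_n>0$ real and $x_1,\dots,x_n\in B$. *)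

theory Defs
  imports
    "HOL-Analysis.Analysis"
    "HOL-Algebra.Group"
    "HOL-Library.Equipollence"
    "HOL-Library.Function_Algebras"
begin

instantiation rat :: topological_space
begin

definition open_rat :: "rat set \<Rightarrow> bool"
  where "open_rat S \<longleftrightarrow> (\<exists>T::real set. open T \<and> S = of_rat -` T)"

instance
proof
  show "open (UNIV :: rat set)"
    unfolding open_rat_def by (intro exI[of _ UNIV]) auto
next
  fix S T :: "rat set"
  assume "open S" "open T"
  then obtain S' T' :: "real set"
    where "open S'" "S = of_rat -` S'" "open T'" "T = of_rat -` T'"
    unfolding open_rat_def by blast
  then show "open (S \<inter> T)"
    unfolding open_rat_def by (intro exI[of _ "S' \<inter> T'"]) auto
next
  fix K :: "rat set set"
  assume "\<forall>S\<in>K. open S"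
  then obtain g :: "rat set \<Rightarrow> real set"
    where "\<forall>S\<in>K. open (g S) \<and> S = of_rat -` g S"
    unfolding open_rat_def by metis
  then show "open (\<Union>K)"
    unfolding open_rat_def by (intro exI[of _ "\<Union>(g ` K)"]) auto
qed

end

definition nowhere_dense :: "'a::topological_space set \<Rightarrow> bool"
  where "nowhere_dense S \<longleftrightarrow> interior (closure S) = {}"

text \<open>Property \<open>BP\<^sub>3'\<close> of the space \<open>UNIV :: 'a set\<close>.\<close>

definition BP3' :: "'a::topological_space itself \<Rightarrow> bool"
  where "BP3' (_ :: 'a itself) \<longleftrightarrow>
    (\<forall>F :: 'a set. nowhere_dense F \<longrightarrow>
      (\<exists>U :: nat \<Rightarrow> 'a set.
        disjoint_family U \<and> (\<forall>m. open (U m) \<and> U m \<noteq> {}) \<and>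
        (\<forall>m. U m \<inter> F = {}) \<and>
        (\<forall>m. F \<subseteq> closure (U m)) \<and>
        UNIV - (F \<union> (\<Union>m\<in>{0<..}. U m)) \<subseteq> closure (U 0)))"

text \<open>The ternary Cantor set: sums of ternary expansions using only the digits 0 and 2.\<close>

definition cantor_set :: "real set"
  where "cantor_set =
    {x. \<exists>d :: nat \<Rightarrow> real. (\<forall>n. d n \<in> {0, 2}) \<and> x = (\<Sum>n. d n / 3 ^ Suc n)}"

text \<open>The constant \<^const>\<open>isCont\<close> is only available for Hausdorff domains, so continuity at a
  point is expressed through the neighbourhood filter.\<close>

definition continuity_points ::
    "('a::topological_space \<Rightarrow> 'b::topological_space) \<Rightarrow> 'a set"
  where "continuity_points f = {x. (f \<longlongrightarrow> f x) (nhds x)}"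

definition super_quasi_continuous ::
    "('a::topological_space \<Rightarrow> 'b::topological_space) \<Rightarrow> bool"
  where "super_quasi_continuous f \<longleftrightarrow>
    (\<forall>x0 W V. open W \<and> x0 \<in> W \<and> open V \<and> f x0 \<in> V \<longrightarrow>
      (\<exists>x \<in> continuity_points f \<inter> W. f x \<in> V))"

definition non_Borel_sqc :: "('a::topological_space \<Rightarrow> 'b::topological_space) set"
  where "non_Borel_sqc = {f. f \<notin> borel_measurable borel \<and> super_quasi_continuous f}"

definition fun_scale :: "'k::field \<Rightarrow> ('a \<Rightarrow> 'k) \<Rightarrow> 'a \<Rightarrow> 'k"
  where "fun_scale c f = (\<lambda>x. c * f x)"

global_interpretation fun_vs: vector_space fun_scale
  by unfold_locales (auto simp: fun_scale_def fun_eq_iff algebra_simps)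

text \<open>In the next two definitions \<open>UNIV :: nat set set\<close> has the cardinality of the continuum.
  The number \<open>dim\<close> of the library is a natural number, so an infinite dimension is given by the
  cardinality of a basis.\<close>

definition continuum_dim_subspace :: "('a \<Rightarrow> 'k::field) set \<Rightarrow> bool"
  where "continuum_dim_subspace V \<longleftrightarrow>
    fun_vs.subspace V \<and>
    (\<exists>B. fun_vs.independent B \<and> fun_vs.span B = V \<and> B \<approx> (UNIV :: nat set set))"

definition additive_group_of_size_continuum :: "('a \<Rightarrow> int) set \<Rightarrow> bool"
  where "additive_group_of_size_continuum G \<longleftrightarrow>
    group \<lparr>carrier = G, monoid.mult = (+), one = 0\<rparr> \<and> G \<approx> (UNIV :: nat set set)"

definition positive_cone :: "('a \<Rightarrow> real) set \<Rightarrow> ('a \<Rightarrow> real) set"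
  where "positive_cone B =
    {f. \<exists>(n::nat) a g. n \<ge> 1 \<and> (\<forall>i\<in>{1..n}. a i > 0 \<and> g i \<in> B) \<and>
          f = (\<Sum>i = 1..n. fun_scale (a i) (g i))}"

definition function_lattice :: "('a \<Rightarrow> 'b::linorder) set \<Rightarrow> bool"
  where "function_lattice L \<longleftrightarrow>
    (\<forall>f\<in>L. \<forall>g\<in>L. (\<lambda>x. max (f x) (g x)) \<in> L \<and> (\<lambda>x. min (f x) (g x)) \<in> L)"

text \<open>Functions into the discrete space \<open>{0, 1}\<close> are represented as integer-valued functions with
  range in \<open>{0, 1}\<close>; since \<open>{0, 1}\<close> is a (discrete) subspace of the discrete space of integers,
  continuity points, super quasi-continuity and Borel measurability do not depend on which of the
  two is taken as the codomain.\<close>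

definition binary_functions :: "('a \<Rightarrow> int) set"
  where "binary_functions = {f. range f \<subseteq> {0, 1}}"

end

theory Submission
  imports Defs
begin

text \<open>A function that is constant on each of the sets \<open>U m\<close> supplied by \<open>BP\<^sub>3'\<close>, that vanishes outside
  \<open>F\<close> and these sets, and whose values on \<open>F\<close> are limits of its values on the \<open>U m\<close> is super
  quasi-continuous, however wild it is on \<open>F\<close>. Since \<open>F\<close> is second countable, the Borel sets have only
  continuum many traces on \<open>F\<close>, so Cantor's diagonal argument on a copy of the continuum inside \<open>F\<close>
  gives sets with non-Borel traces. For groups and linear spaces, one diagonal set in each of
  continuum many disjoint copies is combined with a family of index sets none of which is covered
  by finitely many others; this makes each coefficient of a linear combination a value on some
  \<open>U m\<close>.
  For cones and lattices, a single diagonal set is fixed and the functions vary freely on a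
  second copy of the continuum.\<close>

section \<open>Injections into the power set of the naturals\<close>

text \<open>Splits the continuum into continuum many disjoint copies of itself, one for each
  \<open>x\<close>.\<close>

definition pair_code :: "nat set \<Rightarrow> nat set \<Rightarrow> nat set"
  where "pair_code x y = to_nat ` (x <+> y)"

lemma pair_code_eq_iff: "pair_code x y = pair_code x' y' \<longleftrightarrow> x = x' \<and> y = y'"
proof -
  have "inj (to_nat :: nat + nat \<Rightarrow> nat)" by simp
  then have "pair_code x y = pair_code x' y' \<longleftrightarrow> x <+> y = x' <+> y'"
    unfolding pair_code_def by (rule inj_image_eq_iff)
  also have "\<dots> \<longleftrightarrow> x = x' \<and> y = y'"
    by (auto simp: set_eq_iff Plus_def)
  finally show ?thesis .
qed

text \<open>Positions are strings of zeros. The Boolean, under \<open>None\<close>, is recorded at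
  every position, so an entry with an empty set still leaves a mark.\<close>

primrec list_set_code :: "(nat set \<times> bool) list \<Rightarrow> (nat list \<times> nat option \<times> bool) set"
  where
    "list_set_code [] = {}"
  | "list_set_code (a # l) =
       insert ([], None, snd a) ((\<lambda>n. ([], Some n, True)) ` fst a)
         \<union> (\<lambda>(i, m). (0 # i, m)) ` list_set_code l"

lemma list_set_code_inject: "list_set_code l = list_set_code l' \<Longrightarrow> l = l'"
proof (induction l arbitrary: l')
  case Nil
  then show ?case by (cases l') auto
next
  case (Cons a l)
  obtain b k where l': "l' = b # k" using Cons.prems by (cases l') auto
  have *: "list_set_code r = {(i, m). (0 # i, m) \<in> list_set_code (c # r)}"
    "fst c = {n. ([], Some n, True) \<in> list_set_code (c # r)}"
    "snd c = (([], None, True) \<in> list_set_code (c # r))" for c r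
    by (force simp: image_iff)+
  have "list_set_code l = list_set_code k"
    using *(1)[of l a] *(1)[of k b] Cons.prems l' by metis
  moreover have "fst a = fst b"
    using *(2)[of a l] *(2)[of b k] Cons.prems l' by metis
  moreover have "snd a = snd b"
    using *(3)[of a l] *(3)[of b k] Cons.prems l' by metis
  ultimately show ?case using Cons.IH l' by (simp add: prod_eq_iff)
qed

definition list_code :: "(nat set \<times> bool) list \<Rightarrow> nat set"
  where "list_code l = to_nat ` list_set_code l"

lemma inj_list_code: "inj list_code"
  unfolding list_code_def
  by (rule injI, rule list_set_code_inject) (simp add: inj_image_eq_iff)

text \<open>Each combination is the sum of a finite list of signed members of the family, and such
  lists are coded by \<open>list_code\<close>.\<close>

lemma finite_int_combinations_lepoll:
  fixes f :: "nat set \<Rightarrow> 'a \<Rightarrow> int"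
  shows "{\<lambda>z. \<Sum>x\<in>t. c x * f x z |t c. finite t} \<lesssim> (UNIV :: nat set set)"
proof -
  define unary :: "nat set \<times> int \<Rightarrow> (nat set \<times> bool) list"
    where "unary = (\<lambda>(x, k). replicate (nat \<bar>k\<bar>) (x, k > 0))"
  define val :: "(nat set \<times> bool) list \<Rightarrow> 'a \<Rightarrow> int"
    where "val l = (\<lambda>z. \<Sum>a\<leftarrow>l. (if snd a then 1 else -1) * f (fst a) z)" for l
  have val_append: "val (l @ l') z = val l z + val l' z" for l l' z
    by (simp add: val_def)
  have val_unary: "val (unary (x, k)) z = k * f x z" for x k z
    by (auto simp: val_def unary_def sum_list_replicate)
  have val_concat: "val (concat (map (\<lambda>x. unary (x, c x)) xs)) z = (\<Sum>x\<leftarrow>xs. c x * f x z)" for xs c z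
    by (induction xs) (simp_all add: val_append val_unary, simp add: val_def)
  have "{\<lambda>z. \<Sum>x\<in>t. c x * f x z |t c. finite t} \<subseteq> range val"
  proof clarify
    fix t :: "nat set set" and c :: "nat set \<Rightarrow> int"
    assume "finite t"
    then obtain xs where "set xs = t" "distinct xs" using finite_distinct_list by blast
    then have "(\<lambda>z. \<Sum>x\<in>t. c x * f x z) = val (concat (map (\<lambda>x. unary (x, c x)) xs))"
      by (auto simp: val_concat sum_list_distinct_conv_sum_set)
    then show "(\<lambda>z. \<Sum>x\<in>t. c x * f x z) \<in> range val" by blast
  qed
  then have "{\<lambda>z. \<Sum>x\<in>t. c x * f x z |t c. finite t} \<lesssim> (UNIV :: (nat set \<times> bool) list set)"
    by (rule subset_image_lepoll)
  also have "\<dots> \<lesssim> (UNIV :: nat set set)"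
    using inj_list_code unfolding lepoll_def by blast
  finally show ?thesis .
qed

text \<open>Sequences of correct answers to membership questions about \<open>x\<close>. For \<open>'b = nat\<close> these sets
  of sequences play the role of an almost disjoint family on a countable set.\<close>

definition branch :: "'b set \<Rightarrow> ('b \<times> bool) list set"
  where "branch x = {l. \<forall>(z, b)\<in>set l. b = (z \<in> x)}"

text \<open>A list of correct answers about \<open>x\<close>, asked for each \<open>y\<close> in
  \<open>T\<close> at a point where \<open>x\<close> and \<open>y\<close> differ, is wrong about
  every such \<open>y\<close>.\<close>

lemma branch_separation:
  assumes "finite T" "x \<notin> T"
  obtains l where "l \<in> branch x" "\<And>y. y \<in> T \<Longrightarrow> l \<notin> branch y"
proof -
  obtain w where w: "\<And>y. y \<in> T \<Longrightarrow> w y \<in> x \<longleftrightarrow> w y \<notin> y"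
  proof -
    have "\<exists>z. z \<in> x \<longleftrightarrow> z \<notin> y" if "y \<in> T" for y
    proof -
      have "x \<noteq> y" using that \<open>x \<notin> T\<close> by blast
      then show ?thesis by auto
    qed
    then show ?thesis using that by metis
  qed
  obtain ys where ys: "set ys = T" using finite_list[OF \<open>finite T\<close>] by blast
  let ?l = "map (\<lambda>y. (w y, w y \<in> x)) ys"
  show ?thesis
  proof
    show "?l \<in> branch x" by (auto simp: branch_def)
    show "?l \<notin> branch y" if "y \<in> T" for y
      using w[OF that] that ys by (auto simp: branch_def)
  qed
qed

section \<open>The Cantor set\<close>

lemma sums_ternary: "(\<lambda>n. b / 3 ^ Suc n :: real) sums (b / 2)"
  using sums_mult[OF geometric_sums[of "1/3 :: real"], of "b/3"]
  by (simp add: power_divide)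

lemmas summable_ternary = sums_summable[OF sums_ternary]
  and suminf_ternary = sums_unique[OF sums_ternary, symmetric]

lemma summable_ternary_bounded:
  fixes e :: "nat \<Rightarrow> real"
  assumes "\<And>n. \<bar>e n\<bar> \<le> b"
  shows "summable (\<lambda>n. e n / 3 ^ Suc n)"
  by (rule summable_comparison_test'[OF summable_ternary[of b], of 0])
     (use assms in \<open>simp add: divide_right_mono\<close>)

text \<open>The tail of a ternary expansion has absolute value at most 1, so it cannot cancel a leading
  digit \<open>\<plusminus>2\<close>.\<close>

lemma ternary_digits_zero:
  fixes e :: "nat \<Rightarrow> real"
  assumes "\<And>n. e n \<in> {-2, 0, 2}" "(\<Sum>n. e n / 3 ^ Suc n) = 0"
  shows "e n = 0"
proof -
  have shift: "e 0 = 0 \<and> (\<Sum>n. e (Suc n) / 3 ^ Suc n) = 0"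
    if e: "\<And>n. e n \<in> {-2, 0, 2}" and s: "(\<Sum>n. e n / 3 ^ Suc n) = 0" for e :: "nat \<Rightarrow> real"
  proof -
    have b: "\<bar>e n\<bar> \<le> 2" for n using e[of n] by auto
    then have le: "e n \<le> 2" "-2 \<le> e n" for n by (simp_all add: abs_le_iff minus_le_iff)
    let ?S = "\<Sum>n. e (Suc n) / 3 ^ Suc n"
    have sm: "summable (\<lambda>n. e (Suc n) / 3 ^ Suc n)"
      using summable_ternary_bounded[of "\<lambda>n. e (Suc n)" 2] b by simp
    have "(\<Sum>n. e n / 3 ^ Suc n) = e 0 / 3 + (\<Sum>n. e (Suc n) / 3 ^ Suc (Suc n))"
      using suminf_split_head[OF summable_ternary_bounded[of e 2]] b by simp
    also have "(\<Sum>n. e (Suc n) / 3 ^ Suc (Suc n)) = ?S / 3"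
      using suminf_divide[OF sm, of 3] by (simp add: mult.commute)
    finally have eq: "e 0 + ?S = 0" using s by simp
    have "?S \<le> (\<Sum>n. 2 / 3 ^ Suc n)"
      by (intro suminf_le sm summable_ternary divide_right_mono le) simp
    moreover have "(\<Sum>n. -2 / 3 ^ Suc n) \<le> ?S"
      by (intro suminf_le sm summable_ternary divide_right_mono le) simp
    ultimately have "\<bar>?S\<bar> \<le> 1" unfolding suminf_ternary by simp
    then show ?thesis using eq e[of 0] by auto
  qed
  show ?thesis
    using assms
  proof (induction n arbitrary: e)
    case 0
    then show ?case using shift by blast
  next
    case (Suc n)
    then show ?case using shift[of e] Suc.IH[of "\<lambda>n. e (Suc n)"] by blast
  qed
qed

text \<open>A set of naturals gives the positions of the digit 2. The difference of two such
  expansions has digits -2, 0 and 2, so it is zero only if all its digits are.\<close>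

lemma nat_set_embeds_cantor_set:
  obtains f :: "nat set \<Rightarrow> real" where "inj f" "range f \<subseteq> cantor_set"
proof
  define d :: "nat set \<Rightarrow> nat \<Rightarrow> real" where "d A n = (if n \<in> A then 2 else 0)" for A n
  define f where "f A = (\<Sum>n. d A n / 3 ^ Suc n)" for A
  show "range f \<subseteq> cantor_set"
  proof clarify
    fix A
    have "\<forall>n. d A n \<in> {0, 2}" by (simp add: d_def)
    then show "f A \<in> cantor_set" unfolding f_def cantor_set_def by blast
  qed
  show "inj f"
  proof (rule injI)
    fix A B assume "f A = f B"
    have "summable (\<lambda>n. d A n / 3 ^ Suc n)" for A
      by (rule summable_ternary_bounded[of _ 2]) (simp add: d_def)
    then have "(\<Sum>n. (d A n - d B n) / 3 ^ Suc n) = 0"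
      using \<open>f A = f B\<close> suminf_diff[of "\<lambda>n. d A n / 3 ^ Suc n" "\<lambda>n. d B n / 3 ^ Suc n"]
      by (simp add: f_def diff_divide_distrib)
    then have "d A n - d B n = 0" for n
      by (intro ternary_digits_zero[of "\<lambda>n. d A n - d B n"]) (auto simp: d_def)
    then have "n \<in> A \<longleftrightarrow> n \<in> B" for n
      by (metis d_def eq_iff_diff_eq_0 zero_neq_numeral)
    then show "A = B" by blast
  qed
qed

section \<open>Traces of Borel sets\<close>

text \<open>Well-founded trees recording how a Borel trace arises; bounding their number replaces a
  transfinite Borel hierarchy.\<close>

datatype borel_code = Base "nat set" | Compl borel_code | Union "nat \<Rightarrow> borel_code"

text \<open>The set of pairs of a position and a label there; 0 and 1 label complements and unions, \<open>n + 2\<close>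
  stands for the base index \<open>n\<close>.\<close>

primrec tree :: "borel_code \<Rightarrow> (nat list \<times> nat) set"
  where
    "tree (Base k) = {([], n + 2) |n. n \<in> k}"
  | "tree (Compl c) = insert ([], 0) {(0 # l, m) |l m. (l, m) \<in> tree c}"
  | "tree (Union g) = insert ([], 1) {(n # l, m) |n l m. (l, m) \<in> tree (g n)}"

text \<open>The root label reveals the constructor: only \<open>Base\<close> has neither 0 nor 1
  there. The first step of a position then separates the subtrees.\<close>

lemma tree_inject: "tree c = tree c' \<Longrightarrow> c = c'"
proof (induction c arbitrary: c')
  case (Base k)
  have root: "([], 0) \<notin> tree c'" "([], 1) \<notin> tree c'" unfolding Base[symmetric] by auto
  then obtain j where j: "c' = Base j" by (cases c') auto
  have "n \<in> k \<longleftrightarrow> n \<in> j" for n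
  proof -
    have "([], n + 2) \<in> tree (Base k) \<longleftrightarrow> ([], n + 2) \<in> tree (Base j)"
      using Base j by metis
    then show ?thesis by simp
  qed
  then show ?case using j by blast
next
  case (Compl c)
  have "([], 0) \<in> tree c'" unfolding Compl.prems[symmetric] by simp
  then obtain d where d: "c' = Compl d" by (cases c') auto
  have "(0 # l, m) \<in> tree (Compl c) \<longleftrightarrow> (0 # l, m) \<in> tree (Compl d)" for l m
    unfolding Compl.prems d ..
  then have "tree c = tree d" by auto
  then show ?case using Compl.IH d by simp
next
  case (Union g)
  have "([], 1) \<in> tree c'" unfolding Union.prems[symmetric] by simp
  then obtain h where h: "c' = Union h" by (cases c') auto
  have "(n # l, m) \<in> tree (Union g) \<longleftrightarrow> (n # l, m) \<in> tree (Union h)" for n l m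
    unfolding Union.prems h ..
  then have "tree (g n) = tree (h n)" for n by auto
  then have "g = h" using Union.IH by (intro ext) blast
  then show ?case using h by simp
qed

lemma borel_code_embedding: obtains f :: "borel_code \<Rightarrow> nat set" where "inj f"
proof
  show "inj (\<lambda>c. to_nat ` tree c)"
    by (rule injI, rule tree_inject) (simp add: inj_image_eq_iff)
qed

text \<open>Complements are taken inside \<open>F\<close>: codes describe traces, since a countable
  base is at hand for \<open>F\<close> only.\<close>

primrec interp :: "'a set \<Rightarrow> (nat \<Rightarrow> 'a set) \<Rightarrow> borel_code \<Rightarrow> 'a set"
  where
    "interp F b (Base k) = (\<Union>n\<in>k. b n)"
  | "interp F b (Compl c) = F - interp F b c"
  | "interp F b (Union g) = (\<Union>n. interp F b (g n))"

lemma borel_trace_interp: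
  fixes F :: "'a::topological_space set"
  assumes "\<And>S. open S \<Longrightarrow> \<exists>k. S \<inter> F = (\<Union>n\<in>k. b n)" and "E \<in> sets borel"
  shows "\<exists>c. E \<inter> F = interp F b c"
proof -
  have "E \<in> sigma_sets UNIV {S. open S}"
    using assms(2) unfolding borel_def by (subst (asm) sets_measure_of) auto
  then show ?thesis
  proof induction
    case (Basic S)
    then obtain k where "S \<inter> F = (\<Union>n\<in>k. b n)" using assms(1) by blast
    then have "S \<inter> F = interp F b (Base k)" by simp
    then show ?case by blast
  next
    case Empty
    have "{} \<inter> F = interp F b (Base {})" by simp
    then show ?case by blast
  next
    case (Compl S)
    then obtain c where "S \<inter> F = interp F b c" by blast
    then have "(UNIV - S) \<inter> F = interp F b (borel_code.Compl c)" by auto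
    then show ?case by blast
  next
    case (Union S)
    have "\<forall>n. \<exists>c. S n \<inter> F = interp F b c" using Union.IH by blast
    then obtain g where "\<And>n. S n \<inter> F = interp F b (g n)" by metis
    then have "\<Union>(range S) \<inter> F = interp F b (borel_code.Union g)" by auto
    then show ?case by blast
  qed
qed

text \<open>The homeomorphism pulls a countable base of the Euclidean space back to
  \<open>F\<close>. Traces are then interpretations of codes, and codes embed into
  \<open>nat set\<close>.\<close>

lemma borel_traces_enumeration:
  fixes F :: "'a::topological_space set" and C :: "'b::euclidean_space set"
  assumes "F homeomorphic C"
  obtains tr :: "nat set \<Rightarrow> 'a set" where "\<And>E. E \<in> sets borel \<Longrightarrow> \<exists>e. E \<inter> F = tr e"
proof -
  obtain h g where hom: "homeomorphism F C h g"
    using assms unfolding homeomorphic_def by blast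
  have "\<exists>B :: nat \<Rightarrow> 'b set. \<forall>S. open S \<longrightarrow> (\<exists>k. S = \<Union>{B n |n. n \<in> k})"
  proof (rule univ_second_countable_sequence)
    fix B :: "nat \<Rightarrow> 'b set"
    assume "\<And>S. open S \<Longrightarrow> \<exists>k. S = \<Union>{B n |n. n \<in> k}"
    then show ?thesis by blast
  qed
  then obtain B :: "nat \<Rightarrow> 'b set"
    where B: "\<And>S. open S \<Longrightarrow> \<exists>k. S = \<Union>{B n |n. n \<in> k}"
    by blast
  define b where "b n = {x\<in>F. h x \<in> B n}" for n
  have base: "\<exists>k. S \<inter> F = (\<Union>n\<in>k. b n)" if "open S" for S
  proof -
    have "continuous_on C g" using hom by (simp add: homeomorphism_def)
    then obtain A where A: "open A" "A \<inter> C = g -` S \<inter> C"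
      using \<open>open S\<close> unfolding continuous_on_open_invariant by blast
    obtain k where k: "A = \<Union>{B n |n. n \<in> k}" using B[OF A(1)] by blast
    have "x \<in> S \<longleftrightarrow> h x \<in> A" if "x \<in> F" for x
    proof -
      have "h x \<in> C" "g (h x) = x" using hom that by (auto simp: homeomorphism_def)
      moreover have "h x \<in> A \<inter> C \<longleftrightarrow> h x \<in> g -` S \<inter> C" using A(2) by (rule arg_cong)
      ultimately show ?thesis by simp
    qed
    then have "S \<inter> F = (\<Union>n\<in>k. b n)"
      unfolding b_def k by blast
    then show ?thesis by blast
  qed
  obtain f :: "borel_code \<Rightarrow> nat set" where f: "inj f" by (rule borel_code_embedding)
  show thesis
  proof
    fix E :: "'a set" assume "E \<in> sets borel"
    then obtain c where "E \<inter> F = interp F b c" using borel_trace_interp[OF base] by blast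
    \<comment> \<open>An \<open>e\<close> that codes nothing is decoded arbitrarily; it only matters
      that every trace is hit.\<close>
    then show "\<exists>e. E \<inter> F = interp F b (inv_into UNIV f e)" by (metis f inv_f_f)
  qed
qed

section \<open>Linear combinations of indexed families\<close>

lemma sum_of_bool_single:
  fixes c :: "'i \<Rightarrow> 'k::comm_ring_1"
  assumes "finite t" "y \<in> t" "Q y" "\<And>x. x \<in> t \<Longrightarrow> x \<noteq> y \<Longrightarrow> \<not> Q x"
  shows "(\<Sum>x\<in>t. c x * of_bool (Q x)) = c y"
proof -
  have "(\<Sum>x\<in>t. c x * of_bool (Q x)) = (\<Sum>x\<in>{y}. c x * of_bool (Q x))"
    using assms by (intro sum.mono_neutral_right) auto
  then show ?thesis using assms by simp
qed

lemma sum_fun_scale: "(\<Sum>i\<in>t. fun_scale (c i) (f i)) = (\<lambda>z. \<Sum>i\<in>t. c i * f i z)"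
  by (induction t rule: infinite_finite_induct) (auto simp: fun_scale_def fun_eq_iff)

text \<open>Coefficients 1 and -1 at two indices with equal functions give injectivity; sums over
  functions then become sums over indices.\<close>

lemma independent_range:
  fixes f :: "'i \<Rightarrow> 'a \<Rightarrow> 'k::field"
  assumes indep: "\<forall>t c. finite t \<longrightarrow> (\<forall>z. (\<Sum>x\<in>t. c x * f x z) = 0) \<longrightarrow> (\<forall>x\<in>t. c x = 0)"
  shows "inj f" "fun_vs.independent (range f)"
proof -
  show inj: "inj f"
  proof (rule injI, rule ccontr)
    fix x y assume "f x = f y" "x \<noteq> y"
    then have "(1::'k) = 0"
      using spec[OF spec[OF indep, of "{x, y}"], of "\<lambda>z. if z = x then 1 else -1"] by simp
    then show False by simp
  qed
  show "fun_vs.independent (range f)"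
    unfolding fun_vs.independent_explicit_module
  proof clarify
    fix T u v assume T: "finite T" "T \<subseteq> range f" "(\<Sum>v\<in>T. fun_scale (u v) v) = 0" "v \<in> T"
    then obtain x where x: "v = f x" by blast
    let ?t = "f -` T"
    have t: "finite ?t" using T inj by (simp add: finite_vimageI)
    have "(\<Sum>v\<in>f ` ?t. fun_scale (u v) v) = 0" using T by (simp add: image_vimage_eq Int_absorb2)
    then have "(\<Sum>x\<in>?t. fun_scale (u (f x)) (f x)) = 0"
      by (simp only: sum.reindex[OF inj_on_subset[OF inj subset_UNIV]] o_def)
    then have "(\<Sum>x\<in>?t. u (f x) * f x z) = 0" for z
      by (simp add: sum_fun_scale fun_eq_iff)
    then show "u v = 0" using spec[OF spec[OF indep, of ?t], of "\<lambda>x. u (f x)"] T(4) x t by simp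
  qed
qed

section \<open>Functions glued along the open sets of the property \<open>BP\<^sub>3'\<close>\<close>

text \<open>\<open>P\<close> plants continuum many disjoint copies \<open>P x\<close> of the continuum in \<open>F\<close>, and \<open>tr\<close> enumerates
  the traces on \<open>F\<close> of the Borel sets of the space.\<close>

locale BP3_configuration =
  fixes F :: "'a::topological_space set"
    and U :: "nat \<Rightarrow> 'a set"
    and tr :: "nat set \<Rightarrow> 'a set"
    and P :: "nat set \<Rightarrow> nat set \<Rightarrow> 'a"
  assumes disj: "disjoint_family U"
    and open_U: "\<And>m. open (U m)"
    and U_F: "\<And>m. U m \<inter> F = {}"
    and F_closure: "\<And>m. F \<subseteq> closure (U m)"
    and rest: "UNIV - (F \<union> (\<Union>m\<in>{0<..}. U m)) \<subseteq> closure (U 0)"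
    and tr: "\<And>E. E \<in> sets borel \<Longrightarrow> \<exists>e. E \<inter> F = tr e"
    and P_eq [simp]: "\<And>x y x' y'. P x y = P x' y' \<longleftrightarrow> x = x' \<and> y = y'"
    and P_F [simp]: "\<And>x y. P x y \<in> F"
begin

section \<open>Diagonal sets\<close>

definition diag :: "nat set \<Rightarrow> 'a set"
  where "diag x = {P x e |e. P x e \<notin> tr e}"

lemma P_in_diag [simp]: "P x e \<in> diag y \<longleftrightarrow> x = y \<and> P x e \<notin> tr e"
  by (auto simp: diag_def)

text \<open>For Borel \<open>h\<close> the set where \<open>h\<close> equals \<open>a\<close> would
  have a trace \<open>tr e\<close>, which the point \<open>P x e\<close> refutes. Values off the row
  \<open>P x\<close> are free.\<close>

lemma diag_not_borel:
  assumes "closed {a}" and "\<And>e. h (P x e) = a \<longleftrightarrow> P x e \<notin> tr e"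
  shows "h \<notin> borel_measurable borel"
proof
  assume "h \<in> borel_measurable borel"
  then have "h -` {a} \<in> sets borel"
    using measurable_sets[of h borel borel "{a}"] assms(1) by simp
  then obtain e where "h -` {a} \<inter> F = tr e" using tr by blast
  then have "P x e \<in> tr e \<longleftrightarrow> h (P x e) = a" using P_F[of x e] by auto
  then show False using assms(2) by blast
qed

text \<open>The default \<open>\<phi> 0\<close> suits the remaining points because
  \<open>rest\<close> puts them in the closure of \<open>U 0\<close>.\<close>

definition glue :: "(nat \<Rightarrow> 'b) \<Rightarrow> ('a \<Rightarrow> 'b) \<Rightarrow> 'a \<Rightarrow> 'b"
  where "glue \<phi> g z =
    (if z \<in> F then g z else if \<exists>m. z \<in> U m then \<phi> (THE m. z \<in> U m) else \<phi> 0)"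

lemma glue_F: "z \<in> F \<Longrightarrow> glue \<phi> g z = g z"
  by (simp add: glue_def)

lemma glue_P [simp]: "glue \<phi> g (P x y) = g (P x y)"
  by (simp add: glue_F)

lemma glue_U: assumes "z \<in> U m" shows "glue \<phi> g z = \<phi> m"
proof -
  have "(THE m. z \<in> U m) = m"
    using assms disj by (intro the_equality) (auto simp: disjoint_family_on_def)
  then show ?thesis using assms U_F[of m] by (auto simp: glue_def)
qed

lemma glue_binop:
  "f (glue \<phi> g z) (glue \<phi>' g' z) = glue (\<lambda>m. f (\<phi> m) (\<phi>' m)) (\<lambda>z. f (g z) (g' z)) z"
  by (simp add: glue_def)

lemma glue_combination:
  "(\<Sum>i\<in>t. c i * glue (\<phi> i) (g i) z) = glue (\<lambda>m. \<Sum>i\<in>t. c i * \<phi> i m) (\<lambda>z. \<Sum>i\<in>t. c i * g i z) z"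
  by (simp add: glue_def)

text \<open>All points of the open set \<open>U m\<close> are continuity points with value
  \<open>\<phi> m\<close>, so each point only has to lie in the closure of some \<open>U m\<close>
  with \<open>\<phi> m\<close> in \<open>V\<close>.\<close>

lemma glue_super_quasi_continuous:
  assumes "\<And>z V. z \<in> F \<Longrightarrow> open V \<Longrightarrow> g z \<in> V \<Longrightarrow> \<exists>m. \<phi> m \<in> V"
  shows "super_quasi_continuous (glue \<phi> g)"
  unfolding super_quasi_continuous_def
proof clarify
  fix x0 W V
  assume W: "open W" "x0 \<in> W" and V: "open V" "glue \<phi> g x0 \<in> V"
  obtain m where m: "\<phi> m \<in> V" "x0 \<in> closure (U m)"
  proof (cases "x0 \<in> F")
    case True
    then show ?thesis using assms V that F_closure by (metis glue_F subsetD)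
  next
    case False
    show ?thesis
    proof (cases "\<exists>m. x0 \<in> U m")
      case True
      then show ?thesis using that V glue_U closure_subset by (metis subsetD)
    next
      case no: False
      then have "x0 \<in> closure (U 0)" using rest False by blast
      then show ?thesis using that[of 0] V False no by (simp add: glue_def)
    qed
  qed
  then obtain x where x: "x \<in> U m" "x \<in> W"
    using open_Int_closure_eq_empty[OF W(1), of "U m"] W(2) by blast
  have "\<forall>\<^sub>F y in nhds x. glue \<phi> g y = glue \<phi> g x"
    using open_U x(1) by (auto simp: eventually_nhds glue_U intro!: exI[of _ "U m"])
  then have "(glue \<phi> g \<longlongrightarrow> glue \<phi> g x) (nhds x)"
    by (rule tendsto_eventually)
  then show "\<exists>x\<in>continuity_points (glue \<phi> g) \<inter> W. glue \<phi> g x \<in> V"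
    using x m(1) glue_U[OF x(1), of \<phi> g]
    by (auto simp: continuity_points_def intro!: bexI[of _ x])
qed

section \<open>Generators of the group and of the linear spaces\<close>

text \<open>\<open>U 0\<close> is reserved for the value 0; the other \<open>U m\<close> are indexed
  by lists, and there the generator indicates \<open>branch x\<close>.\<close>

definition gen :: "nat set \<Rightarrow> 'a \<Rightarrow> 'k::comm_ring_1"
  where "gen x = glue (case_nat 0 (\<lambda>k. of_bool (from_nat k \<in> branch x))) (\<lambda>z. of_bool (z \<in> diag x))"

text \<open>The sets \<open>diag x\<close> are disjoint, so on \<open>F\<close> only 0 and single
  coefficients occur. On the row \<open>P x0\<close> the nonzero coefficient of \<open>x0\<close> is
  attained exactly on the diagonal set.\<close>

lemma gen_combination:
  fixes c :: "nat set \<Rightarrow> 'k::{comm_ring_1, topological_space}"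
  assumes closed: "\<And>a :: 'k. closed {a}"
    and t: "finite t" "x0 \<in> t" "c x0 \<noteq> 0"
  shows "(\<lambda>z. \<Sum>x\<in>t. c x * gen x z) \<in> non_Borel_sqc"
proof -
  let ?\<phi> = "\<lambda>m. \<Sum>x\<in>t. c x * (case_nat 0 (\<lambda>k. of_bool (from_nat k \<in> branch x)) m)"
  let ?g = "\<lambda>z. \<Sum>x\<in>t. c x * of_bool (z \<in> diag x)"
  have eq: "(\<lambda>z. \<Sum>x\<in>t. c x * gen x z) = glue ?\<phi> ?g"
    unfolding gen_def glue_combination ..
  note single = sum_of_bool_single[OF t(1)]
  have "?g (P x0 e) = c x0 \<longleftrightarrow> P x0 e \<notin> tr e" for e
  proof (cases "P x0 e \<in> tr e")
    case True
    then show ?thesis using t by simp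
  next
    case False
    then show ?thesis using single[of x0 "\<lambda>x. P x0 e \<in> diag x"] t by auto
  qed
  then have "glue ?\<phi> ?g \<notin> borel_measurable borel"
    by (intro diag_not_borel[of "c x0" _ x0] closed) simp
  moreover have "super_quasi_continuous (glue ?\<phi> ?g)"
  proof (rule glue_super_quasi_continuous)
    fix z V assume V: "?g z \<in> V"
    show "\<exists>m. ?\<phi> m \<in> V"
    proof (cases "\<exists>y\<in>t. z \<in> diag y")
      case True
      then obtain y where y: "y \<in> t" "z \<in> diag y" by blast
      have "?g z = c y" by (rule single) (use y in \<open>auto simp: diag_def\<close>)
      \<comment> \<open>On the \<open>U m\<close> that belongs to \<open>l\<close> all terms but the
        one for \<open>y\<close> vanish.\<close>
      obtain l where l: "l \<in> branch y" "\<And>x. x \<in> t - {y} \<Longrightarrow> l \<notin> branch x"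
        using branch_separation[of "t - {y}" y] t(1) by auto
      have "?\<phi> (Suc (to_nat l)) = c y"
        using single[of y "\<lambda>x. l \<in> branch x"] y l by simp
      then have "?\<phi> (Suc (to_nat l)) \<in> V" using V \<open>?g z = c y\<close> by (simp only:)
      then show ?thesis by (rule exI)
    next
      case False
      then have "?g z = ?\<phi> 0" by (auto intro!: sum.neutral)
      then have "?\<phi> 0 \<in> V" using V by (simp only:)
      then show ?thesis by (rule exI)
    qed
  qed
  ultimately show ?thesis by (simp add: eq non_Borel_sqc_def)
qed

lemma zero_notin_non_Borel_sqc: "(\<lambda>_. c) \<notin> non_Borel_sqc"
  by (simp add: non_Borel_sqc_def)

text \<open>A nonzero coefficient would make the zero function non-Borel.\<close>

lemma gen_combination_zero:
  fixes c :: "nat set \<Rightarrow> 'k::{comm_ring_1, topological_space}"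
  assumes "\<And>a :: 'k. closed {a}" "finite t" "\<And>z. (\<Sum>x\<in>t. c x * gen x z) = 0" "x \<in> t"
  shows "c x = 0"
  using gen_combination[OF assms(1,2,4), of c] zero_notin_non_Borel_sqc assms(3) by auto

lemma gen_group:
  defines "G \<equiv> {\<lambda>z. \<Sum>x\<in>t. c x * gen x z |t c. finite t} :: ('a \<Rightarrow> int) set"
  shows "additive_group_of_size_continuum G" "G \<subseteq> non_Borel_sqc \<union> {0}"
proof -
  have closed: "closed {a}" for a :: int by simp
  define K where "K t c = (\<lambda>z. \<Sum>x\<in>t. c x * (gen x z :: int))" for t c
  have G: "G = {K t c |t c. finite t}" by (simp add: G_def K_def)
  have "K {} c = 0" for c by (simp add: K_def fun_eq_iff)
  then have zero: "0 \<in> G" unfolding G by (metis (mono_tags, lifting) finite.emptyI mem_Collect_eq)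
  have plus: "f + g \<in> G" if fg: "f \<in> G" "g \<in> G" for f g
  proof -
    obtain t c t' c' where t: "finite t" "finite t'" and f: "f = K t c" and g: "g = K t' c'"
      using fg unfolding G by blast
    \<comment> \<open>Padding with zero coefficients brings both summands to a common index
      set.\<close>
    have extend: "K r d = K (t \<union> t') (\<lambda>x. d x * of_bool (x \<in> r))" if "r \<subseteq> t \<union> t'" for r d
      unfolding K_def
    proof (rule ext, rule sum.mono_neutral_cong_left)
      show "finite (t \<union> t')" using t by simp
    qed (use that in auto)
    have "K r d + K r e = K r (\<lambda>x. d x + e x)" for r d e
      by (simp add: K_def fun_eq_iff sum.distrib distrib_right)
    then obtain d where "f + g = K (t \<union> t') d"
      unfolding f g extend[OF Un_upper1] extend[OF Un_upper2] by blast
    then show ?thesis unfolding G using t by blast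
  qed
  have minus: "- f \<in> G" if f: "f \<in> G" for f
  proof -
    obtain t c where t: "finite t" and f: "f = K t c"
      using f unfolding G by blast
    have "- f = K t (\<lambda>x. - c x)" by (simp add: f K_def fun_eq_iff sum_negf)
    then show ?thesis unfolding G using t by blast
  qed
  define M :: "('a \<Rightarrow> int) monoid" where "M = \<lparr>carrier = G, monoid.mult = (+), one = 0\<rparr>"
  have "group M"
  proof (rule groupI)
    fix f assume "f \<in> carrier M"
    then show "\<exists>g\<in>carrier M. g \<otimes>\<^bsub>M\<^esub> f = \<one>\<^bsub>M\<^esub>"
      using minus[of f] by (intro bexI[of _ "- f"]) (simp_all add: M_def)
  qed (use zero plus in \<open>auto simp: M_def add.assoc\<close>)
  moreover have "G \<approx> (UNIV :: nat set set)"
  proof (rule lepoll_antisym)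
    show "G \<lesssim> (UNIV :: nat set set)"
      unfolding G_def by (rule finite_int_combinations_lepoll)
    have "inj (gen :: nat set \<Rightarrow> 'a \<Rightarrow> int)"
    proof (rule injI, rule ccontr)
      fix x y :: "nat set"
      assume eq: "(gen x :: 'a \<Rightarrow> int) = gen y" and "x \<noteq> y"
      then have "(if x = x then 1 else -1 :: int) = 0"
        by (intro gen_combination_zero[where t = "{x, y}" and c = "\<lambda>z. if z = x then 1 else -1"]) auto
      then show False by simp
    qed
    moreover have "range gen \<subseteq> G"
    proof clarify
      fix x
      have "gen x = K {x} (\<lambda>_. 1)" by (simp add: K_def)
      then show "gen x \<in> G" unfolding G by blast
    qed
    ultimately show "(UNIV :: nat set set) \<lesssim> G"
      unfolding lepoll_def by blast
  qed
  ultimately show "additive_group_of_size_continuum G"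
    by (simp add: additive_group_of_size_continuum_def M_def)
  show "G \<subseteq> non_Borel_sqc \<union> {0}"
  proof
    fix f assume "f \<in> G"
    then obtain t c where t: "finite t" and f: "f = K t c" unfolding G by blast
    show "f \<in> non_Borel_sqc \<union> {0}"
    proof (cases "\<exists>x\<in>t. c x \<noteq> 0")
      case True
      then obtain x where "x \<in> t" "c x \<noteq> 0" by blast
      then show ?thesis using gen_combination[OF closed t, of x c] f by (simp add: K_def)
    next
      case False
      then have "f = 0" by (simp add: f K_def fun_eq_iff)
      then show ?thesis by simp
    qed
  qed
qed

lemma gen_span:
  assumes closed: "\<And>a :: 'k::{field, topological_space}. closed {a}"
  defines "V \<equiv> fun_vs.span (range gen) :: ('a \<Rightarrow> 'k) set"
  shows "continuum_dim_subspace V" "V \<subseteq> non_Borel_sqc \<union> {0}"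
proof -
  have "\<forall>t c. finite t \<longrightarrow> (\<forall>z. (\<Sum>x\<in>t. c x * (gen x z :: 'k)) = 0) \<longrightarrow> (\<forall>x\<in>t. c x = 0)"
    by (intro allI impI ballI, rule gen_combination_zero[OF closed]) auto
  note indep = independent_range[OF this]
  have "range (gen :: nat set \<Rightarrow> 'a \<Rightarrow> 'k) \<approx> (UNIV :: nat set set)"
    using indep(1) by (rule inj_on_image_eqpoll_self)
  then show "continuum_dim_subspace V"
    unfolding continuum_dim_subspace_def V_def using indep(2) fun_vs.subspace_span by blast
  show "V \<subseteq> non_Borel_sqc \<union> {0}"
  proof
    fix f assume "f \<in> V"
    then obtain T r where T: "finite T" "T \<subseteq> range gen" and f: "f = (\<Sum>v\<in>T. fun_scale (r v) v)"
      unfolding V_def fun_vs.span_explicit by blast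
    obtain t where t: "finite t" "T = gen ` t"
      using finite_subset_image[OF T] by blast
    have "inj_on (gen :: nat set \<Rightarrow> 'a \<Rightarrow> 'k) t"
      using indep(1) by (rule inj_on_subset) simp
    then have f: "f = (\<lambda>z. \<Sum>x\<in>t. r (gen x) * gen x z)"
      unfolding f t(2) by (simp add: sum.reindex sum_fun_scale)
    show "f \<in> non_Borel_sqc \<union> {0}"
    proof (cases "\<exists>x\<in>t. r (gen x) \<noteq> 0")
      case True
      then obtain x where "x \<in> t" "r (gen x) \<noteq> 0" by blast
      then show ?thesis
        using gen_combination[OF closed t(1), of x "\<lambda>x. r (gen x)"] f by simp
    next
      case False
      then have "f = 0" by (simp add: f fun_eq_iff)
      then show ?thesis by simp
    qed
  qed
qed

section \<open>The lattice\<close>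

text \<open>One diagonal row keeps every set \<open>bin T\<close> non-Borel, while the row \<open>P {0}\<close> can be chosen freely.\<close>

definition bin :: "nat set set \<Rightarrow> 'a set"
  where "bin T = diag {} \<union> P {0} ` T"

lemma P_in_bin [simp]:
  "P {} e \<in> bin T \<longleftrightarrow> P {} e \<notin> tr e"
  "P {0} y \<in> bin T \<longleftrightarrow> y \<in> T"
  by (auto simp: bin_def)

definition bump :: "nat set set \<Rightarrow> 'a \<Rightarrow> int"
  where "bump T = glue (\<lambda>m. of_bool (m = 1)) (\<lambda>z. of_bool (z \<in> bin T))"

text \<open>Unions and intersections of \<open>T\<close> become maxima and minima, as the fixed
  diagonal part and the copy of \<open>T\<close> lie in disjoint rows. The row \<open>P {0}\<close>
  recovers \<open>T\<close>.\<close>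

lemma bump_lattice:
  "function_lattice (range bump)" "range bump \<approx> (UNIV :: nat set set set)"
  "range bump \<subseteq> non_Borel_sqc \<inter> binary_functions"
proof -
  have union: "(\<lambda>z. max (bump T z) (bump T' z)) = bump (T \<union> T')" for T T'
  proof -
    have "z \<in> bin (T \<union> T') \<longleftrightarrow> z \<in> bin T \<or> z \<in> bin T'" for z by (auto simp: bin_def)
    moreover have "max (of_bool A) (of_bool B :: int) = of_bool (A \<or> B)" for A B by auto
    ultimately show ?thesis unfolding bump_def glue_binop[of max] by simp
  qed
  have inter: "(\<lambda>z. min (bump T z) (bump T' z)) = bump (T \<inter> T')" for T T'
  proof -
    have "z \<in> bin (T \<inter> T') \<longleftrightarrow> z \<in> bin T \<and> z \<in> bin T'" for z by (auto simp: bin_def)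
    moreover have "min (of_bool A) (of_bool B :: int) = of_bool (A \<and> B)" for A B by auto
    ultimately show ?thesis unfolding bump_def glue_binop[of min] by simp
  qed
  show "function_lattice (range bump)"
    unfolding function_lattice_def
  proof (intro ballI)
    fix f g assume "f \<in> range bump" "g \<in> range bump"
    then obtain T T' where "f = bump T" "g = bump T'" by blast
    then show "(\<lambda>z. max (f z) (g z)) \<in> range bump \<and> (\<lambda>z. min (f z) (g z)) \<in> range bump"
      using union[of T T'] inter[of T T'] by simp
  qed
  have "inj bump"
  proof (rule injI)
    fix T T' assume "bump T = bump T'"
    then have "bump T (P {0} y) = bump T' (P {0} y)" for y by simp
    then have "y \<in> T \<longleftrightarrow> y \<in> T'" for y by (simp add: bump_def of_bool_eq_iff)
    then show "T = T'" by blast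
  qed
  then show "range bump \<approx> (UNIV :: nat set set set)"
    by (rule inj_on_image_eqpoll_self)
  show "range bump \<subseteq> non_Borel_sqc \<inter> binary_functions"
  proof clarify
    fix T
    have "bump T \<in> binary_functions"
      by (auto simp: binary_functions_def bump_def glue_def)
    moreover have "bump T \<notin> borel_measurable borel"
      by (rule diag_not_borel[of 1 _ "{}"]) (auto simp: bump_def)
    moreover have "super_quasi_continuous (bump T)"
      unfolding bump_def
    proof (rule glue_super_quasi_continuous)
      fix z and V :: "int set" assume "of_bool (z \<in> bin T) \<in> V"
      then show "\<exists>m. of_bool (m = (1::nat)) \<in> V"
        \<comment> \<open>Index and value coincide: 0 is taken on \<open>U 0\<close> and 1 on
          \<open>U 1\<close>.\<close>
        by (intro exI[of _ "of_bool (z \<in> bin T)"]) (auto split: if_splits)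
    qed
    ultimately show "bump T \<in> non_Borel_sqc \<inter> binary_functions"
      by (simp add: non_Borel_sqc_def)
  qed
qed

section \<open>The cone\<close>

text \<open>After a leading 0, an enumeration of the rationals clamped to the unit interval, hence
  dense in it.\<close>

definition heights :: "nat \<Rightarrow> real"
  where "heights = case_nat 0 (\<lambda>k. max 0 (min 1 (of_rat (from_nat k))))"

lemma heights_dense:
  assumes "0 < s" "0 \<le> v" "v \<le> s" "open V" "v \<in> V"
  shows "\<exists>m. s * heights m \<in> V"
proof -
  \<comment> \<open>Clamping inside the preimage makes a rational above 1 near \<open>v / s\<close>
    harmless.\<close>
  let ?W = "(\<lambda>r::real. s * max 0 (min 1 r)) -` V"
  have "open ?W"
    using assms(4) by (intro open_vimage continuous_intros)
  moreover have "v / s \<in> ?W" using assms by (simp add: min_def max_def)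
  ultimately obtain e where e: "e > 0" "\<And>r. dist r (v / s) < e \<Longrightarrow> r \<in> ?W"
    by (auto simp: open_dist)
  obtain q where "v / s < of_rat q" "of_rat q < v / s + e"
    using of_rat_dense[of "v / s" "v / s + e"] e(1) by auto
  then have "of_rat q \<in> ?W" by (intro e(2)) (simp add: dist_real_def)
  then have "s * heights (Suc (to_nat q)) \<in> V" by (simp add: heights_def)
  then show ?thesis ..
qed

text \<open>A positive combination of spikes has on every \<open>U m\<close> the value \<open>s * heights m\<close>, where \<open>s\<close> is the
  sum of its coefficients; all its values on \<open>F\<close> lie in \<open>{0..s}\<close>.\<close>

definition spike :: "nat set set \<Rightarrow> 'a \<Rightarrow> real"
  where "spike T = glue heights (\<lambda>z. of_bool (z \<in> bin T))"

text \<open>All spikes share the diagonal row \<open>P {}\<close>, where a positive combination is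
  \<open>s\<close> on the diagonal set and 0 off it; positive coefficients cannot cancel, so
  \<open>s > 0\<close>.\<close>

lemma positive_cone_spike: "positive_cone (range spike) \<subseteq> non_Borel_sqc"
proof
  fix f assume "f \<in> positive_cone (range spike)"
  then obtain n a g where n: "n \<ge> (1::nat)" and ag: "\<And>i. i \<in> {1..n} \<Longrightarrow> a i > 0 \<and> g i \<in> range spike"
    and f: "f = (\<Sum>i = 1..n. fun_scale (a i) (g i))"
    unfolding positive_cone_def by blast
  have "\<forall>i\<in>{1..n}. \<exists>T. g i = spike T" using ag by blast
  then obtain T where T: "\<And>i. i \<in> {1..n} \<Longrightarrow> g i = spike (T i)" by (auto dest!: bchoice)
  define s where "s = (\<Sum>i = 1..n. a i)"
  have "s > 0" unfolding s_def using n ag by (intro sum_pos) auto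
  let ?g = "\<lambda>z. \<Sum>i = 1..n. a i * of_bool (z \<in> bin (T i))"
  have "f = (\<lambda>z. \<Sum>i = 1..n. a i * spike (T i) z)"
    by (auto simp: f sum_fun_scale T intro!: sum.cong)
  then have f: "f = glue (\<lambda>m. s * heights m) ?g"
    unfolding spike_def glue_combination by (simp add: s_def sum_distrib_right)
  have "f \<notin> borel_measurable borel"
  proof (rule diag_not_borel[of s _ "{}"])
    show "f (P {} e) = s \<longleftrightarrow> P {} e \<notin> tr e" for e
      using \<open>s > 0\<close> by (cases "P {} e \<in> tr e") (simp_all add: f s_def)
  qed simp
  moreover have "super_quasi_continuous f"
    unfolding f
  proof (rule glue_super_quasi_continuous)
    fix z V assume V: "open V" "?g z \<in> V"
    have "0 \<le> ?g z" using ag by (intro sum_nonneg) (auto simp: less_imp_le)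
    moreover have "?g z \<le> s" unfolding s_def using ag by (intro sum_mono) (auto simp: less_imp_le)
    ultimately show "\<exists>m. s * heights m \<in> V" using heights_dense \<open>s > 0\<close> V by blast
  qed
  ultimately show "f \<in> non_Borel_sqc" by (simp add: non_Borel_sqc_def)
qed

text \<open>Unions and intersections yield linear relations among all spikes, hence the restriction
  to codes of \<open>branch A\<close>. On the free row, the code of a separating list isolates one
  coefficient.\<close>

lemma spike_independent:
  fixes f :: "nat set set \<Rightarrow> 'a \<Rightarrow> real"
  defines "f \<equiv> \<lambda>A. spike (list_code ` branch A)"
  shows "inj f" "fun_vs.independent (range f)"
proof -
  have "c A = 0" if t: "finite t" "A \<in> t" and 0: "\<And>z. (\<Sum>A\<in>t. c A * f A z) = 0" for t c A
  proof -
    obtain l where l: "l \<in> branch A" "\<And>B. B \<in> t - {A} \<Longrightarrow> l \<notin> branch B"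
      using branch_separation[of "t - {A}" A] t(1) by auto
    have "list_code l \<in> list_code ` branch B \<longleftrightarrow> l \<in> branch B" for B
      using inj_list_code by (simp add: inj_image_mem_iff)
    then have "(\<Sum>B\<in>t. c B * of_bool (l \<in> branch B)) = 0"
      using 0[of "P {0} (list_code l)"] by (simp add: f_def spike_def)
    then show ?thesis using sum_of_bool_single[OF t, of "\<lambda>B. l \<in> branch B" c] l by simp
  qed
  then have "\<forall>t c. finite t \<longrightarrow> (\<forall>z. (\<Sum>A\<in>t. c A * f A z) = 0) \<longrightarrow> (\<forall>A\<in>t. c A = 0)"
    by simp
  from independent_range[OF this] show "inj f" "fun_vs.independent (range f)" by blast+
qed

end

text \<open>Closed singletons are what the diagonal argument asks of the codomain.\<close>

lemma closed_singleton_rat: "closed {a :: rat}"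
proof -
  have "- {a} = of_rat -` (- {of_rat a :: real})" by auto
  then have "open (- {a})" unfolding open_rat_def by (intro exI[of _ "- {of_rat a}"]) auto
  then show ?thesis by (simp add: closed_def)
qed

theorem theorem15:
  fixes F :: "'a::topological_space set"
  assumes "BP3' TYPE('a)"
    and "closed F" and "nowhere_dense F" and "F homeomorphic cantor_set"
  shows
    "(\<exists>G :: ('a \<Rightarrow> int) set.
        additive_group_of_size_continuum G \<and> G \<subseteq> non_Borel_sqc \<union> {0}) \<and>
     (\<exists>V :: ('a \<Rightarrow> rat) set. continuum_dim_subspace V \<and> V \<subseteq> non_Borel_sqc \<union> {0}) \<and>
     (\<exists>V :: ('a \<Rightarrow> real) set. continuum_dim_subspace V \<and> V \<subseteq> non_Borel_sqc \<union> {0}) \<and>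
     (\<exists>V :: ('a \<Rightarrow> complex) set. continuum_dim_subspace V \<and> V \<subseteq> non_Borel_sqc \<union> {0}) \<and>
     (\<exists>B :: ('a \<Rightarrow> real) set.
        fun_vs.independent B \<and> B \<approx> (UNIV :: nat set set set) \<and>
        positive_cone B \<subseteq> non_Borel_sqc \<union> {0}) \<and>
     (\<exists>L :: ('a \<Rightarrow> int) set.
        function_lattice L \<and> L \<approx> (UNIV :: nat set set set) \<and>
        L \<subseteq> non_Borel_sqc \<inter> binary_functions)"
proof -
  obtain U :: "nat \<Rightarrow> 'a set" where U: "disjoint_family U" "\<And>m. open (U m)" "\<And>m. U m \<inter> F = {}"
    "\<And>m. F \<subseteq> closure (U m)" "UNIV - (F \<union> (\<Union>m\<in>{0<..}. U m)) \<subseteq> closure (U 0)"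
    using assms(1,3) unfolding BP3'_def by metis
  obtain tr :: "nat set \<Rightarrow> 'a set" where tr: "\<And>E. E \<in> sets borel \<Longrightarrow> \<exists>e. E \<inter> F = tr e"
    using borel_traces_enumeration[OF assms(4)] by metis
  obtain h g where hom: "homeomorphism F cantor_set h g"
    using assms(4) unfolding homeomorphic_def by blast
  obtain f :: "nat set \<Rightarrow> real" where f: "inj f" "range f \<subseteq> cantor_set"
    by (rule nat_set_embeds_cantor_set)
  \<comment> \<open>\<open>pair_code\<close> selects the copy, \<open>f\<close> places it in the
    Cantor set and \<open>g\<close> carries it into \<open>F\<close>.\<close>
  define P where "P x y = g (f (pair_code x y))" for x y
  have P_eq: "P x y = P x' y' \<longleftrightarrow> x = x' \<and> y = y'" for x y x' y'
  proof -
    have hg: "h (g (f w)) = f w" for w using hom f(2) by (auto simp: homeomorphism_def)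
    have "P x y = P x' y' \<longleftrightarrow> f (pair_code x y) = f (pair_code x' y')"
      unfolding P_def by (metis hg)
    then show ?thesis using f(1) by (simp add: inj_eq pair_code_eq_iff)
  qed
  have P_F: "P x y \<in> F" for x y
  proof -
    have "g ` cantor_set = F" using hom by (simp add: homeomorphism_def)
    moreover have "f (pair_code x y) \<in> cantor_set" using f(2) by blast
    ultimately show ?thesis unfolding P_def by blast
  qed
  interpret BP3_configuration F U tr P
    by (rule BP3_configuration.intro) (fact U tr P_eq P_F)+
  let ?B = "range (\<lambda>A. spike (list_code ` branch A)) :: ('a \<Rightarrow> real) set"
  have B: "fun_vs.independent ?B" "?B \<approx> (UNIV :: nat set set set)"
    using spike_independent by (auto intro: inj_on_image_eqpoll_self)
  have "positive_cone ?B \<subseteq> positive_cone (range spike)"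
    unfolding positive_cone_def by blast
  then have "positive_cone ?B \<subseteq> non_Borel_sqc \<union> {0}"
    using positive_cone_spike by blast
  then have cone: "\<exists>B :: ('a \<Rightarrow> real) set. fun_vs.independent B \<and> B \<approx> (UNIV :: nat set set set) \<and>
      positive_cone B \<subseteq> non_Borel_sqc \<union> {0}"
    using B by blast
  have rat: "\<exists>V :: ('a \<Rightarrow> rat) set. continuum_dim_subspace V \<and> V \<subseteq> non_Borel_sqc \<union> {0}"
    using gen_span[OF closed_singleton_rat] by blast
  have real: "\<exists>V :: ('a \<Rightarrow> real) set. continuum_dim_subspace V \<and> V \<subseteq> non_Borel_sqc \<union> {0}"
    using gen_span[OF closed_singleton] by blast
  have complex: "\<exists>V :: ('a \<Rightarrow> complex) set. continuum_dim_subspace V \<and> V \<subseteq> non_Borel_sqc \<union> {0}"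
    using gen_span[OF closed_singleton] by blast
  show ?thesis
    by (intro conjI rat real complex cone) (use gen_group bump_lattice in blast)+
qed

end
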